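(* The tropical weight matrix of every planar network is tropical totally nonnegative, and every ($n\times n$) tropical totally nonnegative matrix is the tropical weight matrix of some planar network.
   Context: $\mathbb{R}_{\max}=\mathbb{R}\cup\{-\infty\}$. A planar network is a finite weighted directed planar graph with no directed cycles, drawn in the plane (edges meet only at endpoints) with its edges directed from left to right; it has $n$ sources (on the left) and $n$ targets (on the right), both numbered $1,\dots,n$ from bottom to top. Here edges are weighted by elements of $\mathbb{R}_{\max}$. The weight of a path is the sum of the weights of its edges. The tropical weight matrix of the network is the $n\times n$ matrix over $\mathbb{R}_{\max}$ whose $(i,j)$ entry is the maximal weight of a path from source $i$ to target $j$, and $-\infty$ if no such path exists. For a $d\times d$ matrix $M$ over $\mathbb{R}_{\max}$, $\operatorname{per}(M)=\max_{\sigma\in S_d}\sum_iM_{i,\sigma(i)}$; the weight of $\sigma$ is $\sum_iM_{i,\sigma(i)}$. $M$ is sign-nonsingular if $\operatorname{per}(M)\ne-\infty$ and all permutations of maximum weight have the same parity, and sign-singular otherwise. A matrix over $\mathbb{R}_{\max}$ is tropical totally nonnegative if every square submatrix (rows and columns in natural order) is either sign-singular or has all its maximum-weight permutations even. *)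

theory Defs
  imports
    "HOL-Analysis.Analysis"
    "HOL-Combinatorics.Permutations"
    "Graph_Theory.Graph_Theory"
    "Jordan_Normal_Form.DL_Submatrix"
begin

text \<open>
  Conventions: the tropical semiring of max-plus numbers is the subset of \<open>ereal\<close> obtained by
  removing \<open>\<infinity>\<close>; on it \<open>+\<close> and \<open>\<le>\<close> of \<open>ereal\<close> are the intended ones. Rows, columns, sources and
  targets are numbered from \<open>0\<close>, as matrices of \<open>Jordan_Normal_Form\<close> are; the shift by one changes
  neither the order of the indices nor the parity of a permutation.
\<close>

definition Rmax :: "ereal set" where
  "Rmax = {x. x \<noteq> \<infinity>}"

text \<open>
  The notions for a square matrix read its size off \<open>dim_row\<close>.
\<close>

definition perm_weight :: "ereal mat \<Rightarrow> (nat \<Rightarrow> nat) \<Rightarrow> ereal" where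
  "perm_weight M \<sigma> = (\<Sum>i<dim_row M. M $$ (i, \<sigma> i))"

definition trop_per :: "ereal mat \<Rightarrow> ereal" where
  "trop_per M = Max (perm_weight M ` {\<sigma>. \<sigma> permutes {..<dim_row M}})"

definition max_perms :: "ereal mat \<Rightarrow> (nat \<Rightarrow> nat) set" where
  "max_perms M = {\<sigma>. \<sigma> permutes {..<dim_row M} \<and> perm_weight M \<sigma> = trop_per M}"

definition sign_nonsingular :: "ereal mat \<Rightarrow> bool" where
  "sign_nonsingular M \<longleftrightarrow>
     trop_per M \<noteq> -\<infinity> \<and> (\<forall>\<sigma>\<in>max_perms M. \<forall>\<tau>\<in>max_perms M. evenperm \<sigma> = evenperm \<tau>)"

abbreviation sign_singular :: "ereal mat \<Rightarrow> bool" where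
  "sign_singular M \<equiv> \<not> sign_nonsingular M"

definition tropical_totally_nonnegative :: "ereal mat \<Rightarrow> bool" where
  "tropical_totally_nonnegative M \<longleftrightarrow>
     elements_mat M \<subseteq> Rmax \<and>
     (\<forall>I J. I \<subseteq> {..<dim_row M} \<and> J \<subseteq> {..<dim_col M} \<and> card I = card J \<longrightarrow>
        sign_singular (submatrix M I J) \<or> (\<forall>\<sigma>\<in>max_perms (submatrix M I J). evenperm \<sigma>))"

type_synonym point = "real \<times> real"

text \<open>
  The vertices of the graph are the points of the plane at which they are drawn, and
  \<open>curve N e\<close>, parametrized over \<open>{0..1}\<close>, is the drawing of the edge \<open>e\<close>.
\<close>

record 'e network =
  net_graph :: "(point, 'e) pre_digraph"
  weight :: "'e \<Rightarrow> ereal"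
  curve :: "'e \<Rightarrow> real \<Rightarrow> point"
  source :: "nat \<Rightarrow> point"
  target :: "nat \<Rightarrow> point"

text \<open>
  An edge is directed from left to right if the abscissa strictly increases along its curve.
\<close>

definition drawn_left_to_right :: "'e network \<Rightarrow> bool" where
  "drawn_left_to_right N \<longleftrightarrow>
     (\<forall>e\<in>arcs (net_graph N).
        path (curve N e) \<and>
        pathstart (curve N e) = tail (net_graph N) e \<and>
        pathfinish (curve N e) = head (net_graph N) e \<and>
        strict_mono_on {0..1} (\<lambda>t. fst (curve N e t)))"

text \<open>
  Two distinct edges share only points that are endpoints of both, and an edge passes through
  no vertex other than its own endpoints.
\<close>

definition edges_meet_only_at_endpoints :: "'e network \<Rightarrow> bool" where
  "edges_meet_only_at_endpoints N \<longleftrightarrow>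
     (let G = net_graph N; ends = (\<lambda>e. {tail G e, head G e}) in
       (\<forall>e\<in>arcs G. \<forall>f\<in>arcs G. e \<noteq> f \<longrightarrow>
          path_image (curve N e) \<inter> path_image (curve N f) \<subseteq> ends e \<inter> ends f) \<and>
       (\<forall>e\<in>arcs G. path_image (curve N e) \<inter> verts G \<subseteq> ends e))"

text \<open>
  The network lies in a vertical strip with the sources on its left boundary line and the targets
  on its right one. If sources were merely ordered by height at arbitrary abscissae, an edge could
  pass around another source and the numbering would not be the planar boundary order.
\<close>

definition boundary_vertices :: "nat \<Rightarrow> 'e network \<Rightarrow> bool" where
  "boundary_vertices n N \<longleftrightarrow>
     (\<forall>i<n. source N i \<in> verts (net_graph N) \<and> target N i \<in> verts (net_graph N)) \<and>
     (\<forall>j<n. \<forall>i<j. snd (source N i) < snd (source N j) \<and> snd (target N i) < snd (target N j)) \<and>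
     (\<exists>a b. a < b \<and>
        (\<forall>v\<in>verts (net_graph N). a \<le> fst v \<and> fst v \<le> b) \<and>
        (\<forall>i<n. fst (source N i) = a \<and> fst (target N i) = b))"

definition planar_network :: "nat \<Rightarrow> 'e network \<Rightarrow> bool" where
  "planar_network n N \<longleftrightarrow>
     fin_digraph (net_graph N) \<and>
     (\<nexists>c. pre_digraph.cycle (net_graph N) c) \<and>
     (\<forall>e\<in>arcs (net_graph N). weight N e \<in> Rmax) \<and>
     drawn_left_to_right N \<and>
     edges_meet_only_at_endpoints N \<and>
     boundary_vertices n N"

definition path_weight :: "'e network \<Rightarrow> 'e list \<Rightarrow> ereal" where
  "path_weight N p = sum_list (map (weight N) p)"

definition paths_between :: "'e network \<Rightarrow> point \<Rightarrow> point \<Rightarrow> 'e list set" where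
  "paths_between N u v = {p. pre_digraph.apath (net_graph N) u p v}"

definition tropical_weight_matrix :: "nat \<Rightarrow> 'e network \<Rightarrow> ereal mat" where
  "tropical_weight_matrix n N = mat n n (\<lambda>(i, j).
     if paths_between N (source N i) (target N j) = {} then -\<infinity>
     else Max (path_weight N ` paths_between N (source N i) (target N j)))"

end

theory Submission
  imports Defs
begin

text \<open>
  The theorem holds because both properties are equivalent to one family of inequalities on
  \<open>2 \<times> 2\<close> minors, the Monge inequalities
  \<open>M i l + M k j \<le> M i j + M k l\<close> for \<open>i < k\<close> and \<open>j < l\<close>.
  
  Total nonnegativity of a \<open>2 \<times> 2\<close> submatrix says exactly that its antidiagonal does not beat its
  diagonal, which is the Monge inequality. Conversely the Monge inequality lets one uncross a
  permutation entry by entry without losing weight, so in every square submatrix the identity is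
  among the permutations of maximum weight; if all of them have the same parity, they are
  therefore even (\<open>tropical_totally_nonnegative_iff\<close>).
  
  The weight matrix of a planar network satisfies the Monge inequalities by the exchange argument of
  Lindstroem: since edges run from left to right, every path is the graph of a continuous function
  over the whole strip, so a path from source \<open>i\<close> to target \<open>l\<close> and one from source \<open>k\<close> to target
  \<open>j\<close> meet by the intermediate value theorem, and planarity makes them meet in a vertex
  (\<open>walks_cross_in_vertex\<close>). Swapping their tails there gives paths from \<open>i\<close> to \<open>j\<close> and from \<open>k\<close> to
  \<open>l\<close> of the same total weight.
  
  For the converse, take the square lattice turned by 45 degrees, so that one step in a row runs up
  and to the right and one step in a column runs down and to the right. From source \<open>i\<close> the path
  that follows row \<open>i\<close> up to column \<open>j\<close> and then descends along column \<open>j\<close> ends in target \<open>j\<close>. Give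
  column steps weight \<open>0\<close> and the step from column \<open>q\<close> to \<open>q + 1\<close> in row \<open>p\<close> the increment
  \<open>M p (q + 1) - M p q\<close>; then this path has weight \<open>M i j\<close>. Any other path from \<open>i\<close> to \<open>j\<close> makes some
  of its row steps in a lower row, where by the Monge inequality the increments are no larger. So the
  maximal weight is \<open>M i j\<close> (\<open>potential_step\<close>, \<open>peak_walk\<close>).
  
  The entries \<open>-\<infinity>\<close> need care, because increments are then undefined. Once columns
  that are \<open>-\<infinity>\<close> throughout are overwritten by a neighbouring column, the Monge inequalities force the
  finite entries of every row to form an interval, with left ends that move to the right from row to
  row (\<open>filled_finite_interval\<close>, \<open>row_start_mono\<close>); blocking all descents to the left of these ends
  and all row steps that leave the intervals keeps the argument intact.
\<close>

section \<open>Total nonnegativity and the Monge inequalities\<close>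

definition tropical_monge :: "ereal mat \<Rightarrow> bool" where
  "tropical_monge M \<longleftrightarrow>
     (\<forall>i k j l. i < k \<and> k < dim_row M \<and> j < l \<and> l < dim_col M \<longrightarrow>
        M $$ (i, l) + M $$ (k, j) \<le> M $$ (i, j) + M $$ (k, l))"

lemma tropical_mongeD:
  "\<lbrakk>tropical_monge M; i < k; k < dim_row M; j < l; l < dim_col M\<rbrakk> \<Longrightarrow>
     M $$ (i, l) + M $$ (k, j) \<le> M $$ (i, j) + M $$ (k, l)"
  by (simp add: tropical_monge_def)

text \<open>
  If \<open>\<sigma>\<close> moves the last row \<open>d\<close>, let \<open>k\<close> be the row that it sends to column \<open>d\<close>. The Monge
  inequality for the rows \<open>k < d\<close> allows exchanging the values at \<open>k\<close> and \<open>d\<close>, which makes \<open>\<sigma>\<close> fix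
  \<open>d\<close> without decreasing the weight; induction handles the remaining rows.
\<close>

lemma diagonal_weight_is_maximal:
  fixes a :: "nat \<Rightarrow> nat \<Rightarrow> ereal"
  assumes "\<And>i k j l. \<lbrakk>i < k; k < d; j < l; l < d\<rbrakk> \<Longrightarrow> a i l + a k j \<le> a i j + a k l"
    and "\<sigma> permutes {..<d}"
  shows "(\<Sum>i<d. a i (\<sigma> i)) \<le> (\<Sum>i<d. a i i)"
  using assms
proof (induction d arbitrary: \<sigma>)
  case 0
  then show ?case by simp
next
  case (Suc d)
  have restrict: "(\<Sum>i<Suc d. a i (\<tau> i)) \<le> (\<Sum>i<Suc d. a i i)"
    if \<tau>: "\<tau> permutes {..<Suc d}" "\<tau> d = d" for \<tau>
  proof -
    have "\<tau> permutes {..<d}"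
      by (rule permutes_superset[OF \<tau>(1)]) (use \<tau>(2) in \<open>auto simp: less_Suc_eq\<close>)
    then have "(\<Sum>i<d. a i (\<tau> i)) \<le> (\<Sum>i<d. a i i)"
      by (intro Suc.IH) (auto intro: Suc.prems(1))
    then show ?thesis using \<tau>(2) by (simp add: add_mono)
  qed
  show ?case
  proof (cases "\<sigma> d = d")
    case True
    then show ?thesis using restrict Suc.prems(2) by blast
  next
    case False
    define k where "k = inv_into UNIV \<sigma> d"
    have \<sigma>k: "\<sigma> k = d" unfolding k_def using Suc.prems(2) by (simp add: permutes_inverses(1))
    have "\<sigma> k \<in> {..<Suc d}" using \<sigma>k by simp
    then have "k \<in> {..<Suc d}" using permutes_in_image[OF Suc.prems(2), of k] by simp
    with \<sigma>k False have k: "k < d" by (auto simp: less_Suc_eq)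
    have "\<sigma> d \<in> {..<Suc d}" using permutes_in_image[OF Suc.prems(2), of d] by simp
    with False have m: "\<sigma> d < d" by (auto simp: less_Suc_eq)
    define \<tau> where "\<tau> = \<sigma> \<circ> Transposition.transpose k d"
    have \<tau>: "\<tau> permutes {..<Suc d}"
      unfolding \<tau>_def using k
      by (intro permutes_compose[OF _ Suc.prems(2)] permutes_swap_id) auto
    have \<tau>_simps: "\<tau> k = \<sigma> d" "\<tau> d = d" "\<And>i. i \<noteq> k \<Longrightarrow> i \<noteq> d \<Longrightarrow> \<tau> i = \<sigma> i"
      by (simp_all add: \<tau>_def \<sigma>k Transposition.transpose_def)
    have split: "(\<Sum>i<Suc d. f i) = (f k + f d) + (\<Sum>i\<in>{..<d} - {k}. f i)" for f :: "nat \<Rightarrow> ereal"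
      using sum.remove[of "{..<d}" k f] k by (simp add: ac_simps)
    have "a k d + a d (\<sigma> d) \<le> a k (\<sigma> d) + a d d"
      using Suc.prems(1)[of k d "\<sigma> d" d] k m by simp
    then have "(\<Sum>i<Suc d. a i (\<sigma> i)) \<le> (\<Sum>i<Suc d. a i (\<tau> i))"
      unfolding split using \<tau>_simps by (auto simp: \<sigma>k intro!: add_mono sum_mono)
    also have "\<dots> \<le> (\<Sum>i<Suc d. a i i)"
      using restrict \<tau> \<tau>_simps(2) by blast
    finally show ?thesis .
  qed
qed

lemma submatrix_square:
  assumes "I \<subseteq> {..<dim_row M}" "J \<subseteq> {..<dim_col M}" "card I = card J"
  shows "dim_row (submatrix M I J) = card I" "dim_col (submatrix M I J) = card I"
proof -
  have "{i. i < dim_row M \<and> i \<in> I} = I" "{j. j < dim_col M \<and> j \<in> J} = J"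
    using assms by auto
  then show "dim_row (submatrix M I J) = card I" "dim_col (submatrix M I J) = card I"
    by (simp_all add: dim_submatrix assms(3))
qed

lemma tropical_monge_submatrix:
  assumes "tropical_monge M"
  shows "tropical_monge (submatrix M I J)"
  unfolding tropical_monge_def
proof (intro allI impI)
  fix i k j l
  assume *: "i < k \<and> k < dim_row (submatrix M I J) \<and> j < l \<and> l < dim_col (submatrix M I J)"
  define I' J' where "I' = {i. i < dim_row M \<and> i \<in> I}" and "J' = {j. j < dim_col M \<and> j \<in> J}"
  have bounds: "i < card I'" "k < card I'" "j < card J'" "l < card J'"
    using * by (auto simp: I'_def J'_def dim_submatrix)
  have "card I' \<le> card I" if "finite I" using that by (intro card_mono) (auto simp: I'_def)
  moreover have "card J' \<le> card J" if "finite J" using that by (intro card_mono) (auto simp: J'_def)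
  ultimately have "k < card I \<or> infinite I" "l < card J \<or> infinite J" using bounds by force+
  then have "pick I i < pick I k" "pick J j < pick J l"
    using * by (auto intro: pick_mono_le pick_mono_inf)
  moreover have "pick I k < dim_row M" "pick J l < dim_col M"
    using bounds by (auto simp: I'_def J'_def intro: pick_le)
  ultimately have "M $$ (pick I i, pick J l) + M $$ (pick I k, pick J j)
      \<le> M $$ (pick I i, pick J j) + M $$ (pick I k, pick J l)"
    using assms by (intro tropical_mongeD)
  then show "submatrix M I J $$ (i, l) + submatrix M I J $$ (k, j)
      \<le> submatrix M I J $$ (i, j) + submatrix M I J $$ (k, l)"
    using bounds by (simp add: submatrix_index I'_def J'_def)
qed

lemma tropical_monge_imp_tropical_totally_nonnegative:
  assumes "elements_mat M \<subseteq> Rmax" "tropical_monge M"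
  shows "tropical_totally_nonnegative M"
  unfolding tropical_totally_nonnegative_def
proof (intro conjI assms(1) allI impI)
  fix I J
  assume IJ: "I \<subseteq> {..<dim_row M} \<and> J \<subseteq> {..<dim_col M} \<and> card I = card J"
  define S where "S = submatrix M I J"
  have dim: "dim_col S = dim_row S" using IJ submatrix_square[of I M J] by (simp add: S_def)
  have "tropical_monge S" unfolding S_def by (rule tropical_monge_submatrix[OF assms(2)])
  then have "perm_weight S \<sigma> \<le> perm_weight S id" if "\<sigma> permutes {..<dim_row S}" for \<sigma>
    unfolding perm_weight_def id_apply using that dim
    by (intro diagonal_weight_is_maximal) (auto intro: tropical_mongeD)
  then have "trop_per S = perm_weight S id"
    unfolding trop_per_def
    by (intro Max_eqI) (auto simp: finite_permutations permutes_id)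
  then have "id \<in> max_perms S" by (simp add: max_perms_def permutes_id)
  then have "sign_singular S \<or> (\<forall>\<sigma>\<in>max_perms S. evenperm \<sigma>)"
    unfolding sign_nonsingular_def by (metis evenperm_id)
  then show "sign_singular (submatrix M I J) \<or> (\<forall>\<sigma>\<in>max_perms (submatrix M I J). evenperm \<sigma>)"
    by (simp add: S_def)
qed

lemma permutes_two:
  "{\<sigma>. \<sigma> permutes {..<2::nat}} = {id, Transposition.transpose 0 1}"
proof -
  have "{..<2::nat} = {0, 1}" by auto
  then show ?thesis using permutes_doubleton_iff[of _ "0::nat" 1] by auto
qed

text \<open>
  If a Monge inequality failed, the transposition, which is odd, would be the only permutation of
  maximum weight in the corresponding \<open>2 \<times> 2\<close> submatrix, and its weight would be finite.
\<close>

lemma tropical_totally_nonnegative_imp_tropical_monge: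
  assumes "tropical_totally_nonnegative M"
  shows "tropical_monge M"
  unfolding tropical_monge_def
proof (intro allI impI, rule ccontr)
  fix i k j l
  assume *: "i < k \<and> k < dim_row M \<and> j < l \<and> l < dim_col M"
    and neg: "\<not> M $$ (i, l) + M $$ (k, j) \<le> M $$ (i, j) + M $$ (k, l)"
  define S where "S = submatrix M {i, k} {j, l}"
  have sq: "dim_row S = 2" using * submatrix_square(1)[of "{i, k}" M "{j, l}"] by (auto simp: S_def)
  have "{a \<in> {i, k}. a < i} = {}" "{a \<in> {i, k}. a < k} = {i}"
       "{a \<in> {j, l}. a < j} = {}" "{a \<in> {j, l}. a < l} = {j}" using * by auto
  then have c: "card {a \<in> {i, k}. a < i} = 0" "card {a \<in> {i, k}. a < k} = 1"
       "card {a \<in> {j, l}. a < j} = 0" "card {a \<in> {j, l}. a < l} = 1"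
    by (simp_all only: card.empty card_1_singleton_iff) auto
  have S: "S $$ (0, 0) = M $$ (i, j)" "S $$ (0, 1) = M $$ (i, l)"
      "S $$ (1, 0) = M $$ (k, j)" "S $$ (1, 1) = M $$ (k, l)"
    unfolding S_def
    using * submatrix_index_card[of i M j "{i, k}" "{j, l}", unfolded c]
      submatrix_index_card[of i M l "{i, k}" "{j, l}", unfolded c]
      submatrix_index_card[of k M j "{i, k}" "{j, l}", unfolded c]
      submatrix_index_card[of k M l "{i, k}" "{j, l}", unfolded c]
    by (simp_all del: One_nat_def)
  define s where "s = Transposition.transpose (0::nat) 1"
  have "{..<2::nat} = {0, 1}" by auto
  then have w: "perm_weight S id = M $$ (i, j) + M $$ (k, l)" "perm_weight S s = M $$ (i, l) + M $$ (k, j)"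
    unfolding perm_weight_def sq using S by (simp_all add: s_def del: One_nat_def)
  have less: "perm_weight S id < perm_weight S s" using neg w by simp
  have perms: "{\<sigma>. \<sigma> permutes {..<dim_row S}} = {id, s}"
    by (simp only: sq permutes_two s_def)
  have per: "trop_per S = perm_weight S s"
    unfolding trop_per_def perms using less by simp
  have "max_perms S = {\<sigma> \<in> {id, s}. perm_weight S \<sigma> = trop_per S}"
    unfolding max_perms_def perms[symmetric] by simp
  then have "max_perms S = {s}" using less per by auto
  moreover have "\<not> evenperm s" by (simp add: s_def evenperm_swap)
  moreover have "trop_per S \<noteq> -\<infinity>" using less per by auto
  ultimately have "\<not> (sign_singular S \<or> (\<forall>\<sigma>\<in>max_perms S. evenperm \<sigma>))"
    by (simp add: sign_nonsingular_def)
  then show False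
    using assms[unfolded tropical_totally_nonnegative_def, THEN conjunct2, rule_format,
        of "{i, k}" "{j, l}"] * by (auto simp: S_def)
qed

theorem tropical_totally_nonnegative_iff:
  "tropical_totally_nonnegative M \<longleftrightarrow> elements_mat M \<subseteq> Rmax \<and> tropical_monge M"
  using tropical_monge_imp_tropical_totally_nonnegative tropical_totally_nonnegative_imp_tropical_monge
  by (auto simp: tropical_totally_nonnegative_def)

section \<open>Weight matrices of planar networks\<close>

text \<open>
  The abscissa is a continuous bijection from the compact parameter interval, so its inverse is
  continuous and reparametrizes the curve by its abscissa.
\<close>

lemma left_to_right_curve_is_graph:
  fixes \<gamma> :: "real \<Rightarrow> point"
  assumes "path \<gamma>" and mono: "strict_mono_on {0..1} (\<lambda>t. fst (\<gamma> t))"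
  obtains g where "continuous_on {fst (\<gamma> 0)..fst (\<gamma> 1)} g"
    "\<And>x. x \<in> {fst (\<gamma> 0)..fst (\<gamma> 1)} \<Longrightarrow> (x, g x) \<in> path_image \<gamma>"
    "g (fst (\<gamma> 0)) = snd (\<gamma> 0)" "g (fst (\<gamma> 1)) = snd (\<gamma> 1)"
proof -
  define a where "a = (\<lambda>t. fst (\<gamma> t))"
  define h where "h = the_inv_into {0..1} a"
  have cont: "continuous_on {0..1} \<gamma>" using assms(1) by (simp add: path_def)
  have conta: "continuous_on {0..1} a" unfolding a_def by (intro continuous_on_fst cont)
  have inj: "inj_on a {0..1}" using mono unfolding a_def by (rule strict_mono_on_imp_inj_on)
  have img: "a ` {0..1} = {a 0..a 1}"
  proof
    show "a ` {0..1} \<subseteq> {a 0..a 1}"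
      using strict_mono_on_leD[OF mono] by (auto simp: a_def)
    show "{a 0..a 1} \<subseteq> a ` {0..1}"
      using IVT'[of a 0 _ 1, OF _ _ _ conta] by force
  qed
  have ha: "h (a t) = t" if "t \<in> {0..1}" for t
    unfolding h_def using inj that by (rule the_inv_into_f_f)
  have conth: "continuous_on {a 0..a 1} h"
    unfolding h_def img[symmetric] by (rule continuous_on_inv_into[OF conta _ inj]) simp
  have h01: "h ` {a 0..a 1} \<subseteq> {0..1}"
    unfolding img[symmetric] using ha by auto
  define g where "g = (\<lambda>x. snd (\<gamma> (h x)))"
  have "continuous_on {a 0..a 1} g"
    unfolding g_def using conth h01 by (intro continuous_on_snd continuous_on_compose2[OF cont])
  moreover have "(x, g x) \<in> path_image \<gamma>" if "x \<in> {a 0..a 1}" for x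
  proof -
    from that obtain t where t: "t \<in> {0..1}" "x = a t" unfolding img[symmetric] by blast
    then have "(x, g x) = \<gamma> t" using ha by (simp add: a_def g_def)
    then show ?thesis using t(1) by (simp add: path_image_def)
  qed
  moreover have "g (a 0) = snd (\<gamma> 0)" "g (a 1) = snd (\<gamma> 1)" using ha by (simp_all add: g_def)
  ultimately show ?thesis by (intro that[of g]) (simp_all add: a_def)
qed

lemma arc_increases_abscissa:
  assumes "drawn_left_to_right N" "e \<in> arcs (net_graph N)"
  shows "fst (tail (net_graph N) e) < fst (head (net_graph N) e)"
proof -
  have "fst (curve N e 0) < fst (curve N e 1)"
    using assms by (auto simp: drawn_left_to_right_def intro: strict_mono_onD)
  then show ?thesis
    using assms by (auto simp: drawn_left_to_right_def pathstart_def pathfinish_def)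
qed

text \<open>
  Gluing the graphs of consecutive edges. The starting point \<open>u\<close> is added to the drawing of
  the walk because the walk without edges consists of this point only.
\<close>

lemma walk_is_graph:
  assumes wf: "wf_digraph (net_graph N)" and drawn: "drawn_left_to_right N"
    and "pre_digraph.awalk (net_graph N) u p v"
  shows "fst u \<le> fst v \<and>
    (\<exists>g. continuous_on {fst u..fst v} g \<and> g (fst u) = snd u \<and> g (fst v) = snd v \<and>
      (\<forall>x\<in>{fst u..fst v}. (x, g x) \<in> insert u (\<Union>e\<in>set p. path_image (curve N e))))"
  using assms(3)
proof (induction p arbitrary: u)
  case Nil
  then have "u = v" using wf_digraph.awalk_Nil_iff[OF wf] by blast
  then show ?case by (auto intro!: exI[of _ "\<lambda>_. snd u"])
next
  case (Cons e p)
  define G where "G = net_graph N"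
  define w where "w = head G e"
  from Cons.prems have e: "e \<in> arcs G" "tail G e = u" and p: "pre_digraph.awalk G w p v"
    using wf_digraph.awalk_Cons_iff[OF wf] by (auto simp: G_def w_def)
  from Cons.IH[OF p[unfolded G_def]] obtain g2 where wv: "fst w \<le> fst v" and
    g2: "continuous_on {fst w..fst v} g2" "g2 (fst w) = snd w" "g2 (fst v) = snd v"
      "\<And>x. x \<in> {fst w..fst v} \<Longrightarrow> (x, g2 x) \<in> insert w (\<Union>e\<in>set p. path_image (curve N e))"
    by blast
  have uw: "fst u < fst w" using arc_increases_abscissa[OF drawn] e by (auto simp: G_def w_def)
  have curve: "path (curve N e)" "strict_mono_on {0..1} (\<lambda>t. fst (curve N e t))"
      "curve N e 0 = u" "curve N e 1 = w"
    using drawn e by (auto simp: drawn_left_to_right_def G_def w_def pathstart_def pathfinish_def)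
  obtain g1 where g1: "continuous_on {fst u..fst w} g1" "g1 (fst u) = snd u" "g1 (fst w) = snd w"
      "\<And>x. x \<in> {fst u..fst w} \<Longrightarrow> (x, g1 x) \<in> path_image (curve N e)"
    using left_to_right_curve_is_graph[OF curve(1,2)] curve(3,4) by metis
  have w_on: "w \<in> path_image (curve N e)" using curve(4) by (auto simp: path_image_def)
  define g where "g = (\<lambda>x. if x \<le> fst w then g1 x else g2 x)"
  have "continuous_on {fst u..fst v} g"
    unfolding g_def
  proof (rule continuous_on_cases_le)
    have "{x \<in> {fst u..fst v}. x \<le> fst w} = {fst u..fst w}" using wv by auto
    then show "continuous_on {x \<in> {fst u..fst v}. x \<le> fst w} g1" using g1(1) by simp
    have "{x \<in> {fst u..fst v}. fst w \<le> x} = {fst w..fst v}" using uw by auto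
    then show "continuous_on {x \<in> {fst u..fst v}. fst w \<le> x} g2" using g2(1) by simp
  qed (auto simp: g1 g2 intro: continuous_on_id)
  moreover have "g (fst u) = snd u" using uw g1(2) by (simp add: g_def)
  moreover have "g (fst v) = snd v"
    using wv g2(2,3) g1(3) by (cases "fst v = fst w") (auto simp: g_def)
  moreover have "(x, g x) \<in> insert u (\<Union>e\<in>set (e # p). path_image (curve N e))"
    if "x \<in> {fst u..fst v}" for x
    using that g1(4)[of x] g2(4)[of x] w_on by (cases "x \<le> fst w") (auto simp: g_def)
  ultimately show ?case using uw wv by (intro conjI exI[of _ g] ballI) simp_all
qed

text \<open>
  The abscissa strictly increases along a walk, so no vertex is visited twice. This is why walks
  can be concatenated freely below although the weight matrix is defined by paths.
\<close>

lemma awalk_imp_apath: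
  assumes wf: "wf_digraph (net_graph N)" and drawn: "drawn_left_to_right N"
    and "pre_digraph.awalk (net_graph N) u p v"
  shows "pre_digraph.apath (net_graph N) u p v"
  using assms(3)
proof (induction p arbitrary: u)
  case Nil
  then show ?case by (auto simp: wf_digraph.apath_Nil_iff[OF wf] wf_digraph.awalk_Nil_iff[OF wf])
next
  case (Cons e p)
  interpret wf_digraph "net_graph N" by (rule wf)
  from Cons.prems have e: "e \<in> arcs (net_graph N)" "u = tail (net_graph N) e"
    and p: "awalk (head (net_graph N) e) p v" by (auto simp: awalk_Cons_iff)
  \<comment> \<open>No vertex of the remaining walk lies to the left of its start.\<close>
  have right: "fst (head (net_graph N) e) \<le> fst w" if "w \<in> set (awalk_verts (head (net_graph N) e) p)" for w
    using awalk_decomp[OF p that] walk_is_graph[OF wf drawn] by blast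
  have "tail (net_graph N) e \<notin> set (awalk_verts (head (net_graph N) e) p)"
    using arc_increases_abscissa[OF drawn e(1)] right[of "tail (net_graph N) e"] by auto
  then show ?case using Cons.IH[OF p] e by (simp add: apath_Cons_iff)
qed

lemma no_cycle:
  assumes wf: "wf_digraph (net_graph N)" and drawn: "drawn_left_to_right N"
  shows "\<not> pre_digraph.cycle (net_graph N) c"
proof
  interpret wf_digraph "net_graph N" by (rule wf)
  assume "cycle c"
  then obtain u where "awalk u c u" "c \<noteq> []" by (auto simp: cycle_def)
  then show False using awalk_imp_apath[OF wf drawn] apath_nonempty_ends by blast
qed

text \<open>
  The graphs of the two walks change their vertical order across the strip, so they meet.
  If the meeting point lies on two different edges, it is an endpoint of both; if it lies on a
  common edge, the tail of that edge is a common vertex.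
\<close>

lemma walks_cross_in_vertex:
  assumes wf: "wf_digraph (net_graph N)" and drawn: "drawn_left_to_right N"
    and meet: "edges_meet_only_at_endpoints N"
    and p: "pre_digraph.awalk (net_graph N) u p v" and q: "pre_digraph.awalk (net_graph N) u' q v'"
    and strip: "fst u' = fst u" "fst v' = fst v" "fst u < fst v"
    and order: "snd u < snd u'" "snd v' < snd v"
  obtains w where "w \<in> set (pre_digraph.awalk_verts (net_graph N) u p)"
    "w \<in> set (pre_digraph.awalk_verts (net_graph N) u' q)"
proof -
  interpret wf_digraph "net_graph N" by (rule wf)
  have start: "z \<in> (\<Union>e\<in>set r. path_image (curve N e))"
    if "awalk x r y" "fst x < fst y" "z \<in> insert x (\<Union>e\<in>set r. path_image (curve N e))" for x r y z
  proof -
    from that obtain e r' where "r = e # r'" by (cases r) (auto simp: awalk_Nil_iff)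
    moreover from this that drawn have "x \<in> path_image (curve N e)"
      using pathstart_in_path_image[of "curve N e"]
      by (auto simp: awalk_Cons_iff drawn_left_to_right_def)
    ultimately show ?thesis using that(3) by auto
  qed
  obtain g where g: "continuous_on {fst u..fst v} g" "g (fst u) = snd u" "g (fst v) = snd v"
    "\<And>x. x \<in> {fst u..fst v} \<Longrightarrow> (x, g x) \<in> insert u (\<Union>e\<in>set p. path_image (curve N e))"
    using walk_is_graph[OF wf drawn p] by blast
  obtain g' where g': "continuous_on {fst u..fst v} g'" "g' (fst u) = snd u'" "g' (fst v) = snd v'"
    "\<And>x. x \<in> {fst u..fst v} \<Longrightarrow> (x, g' x) \<in> insert u' (\<Union>e\<in>set q. path_image (curve N e))"
    using walk_is_graph[OF wf drawn q] strip by auto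
  have "continuous_on {fst u..fst v} (\<lambda>x. g x - g' x)" by (intro continuous_on_diff g(1) g'(1))
  then obtain x where x: "x \<in> {fst u..fst v}" "g x = g' x"
    using IVT'[of "\<lambda>x. g x - g' x" "fst u" 0 "fst v"] strip order g(2,3) g'(2,3) by auto
  have "(x, g x) \<in> (\<Union>e\<in>set p. path_image (curve N e))"
    using start[OF p strip(3) g(4)[OF x(1)]] .
  moreover have "(x, g x) \<in> (\<Union>e\<in>set q. path_image (curve N e))"
    using start[OF q _ g'(4)[OF x(1)]] strip x(2) by simp
  ultimately obtain e f where e: "e \<in> set p" "(x, g x) \<in> path_image (curve N e)"
    and f: "f \<in> set q" "(x, g x) \<in> path_image (curve N f)" by blast
  have arcs: "e \<in> arcs (net_graph N)" "f \<in> arcs (net_graph N)" using e f p q by blast+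
  show thesis
  proof (cases "e = f")
    case True
    then show thesis using that awalk_verts_arc1 e(1) f(1) by blast
  next
    case False
    then have "(x, g x) \<in> {tail (net_graph N) e, head (net_graph N) e} \<inter>
        {tail (net_graph N) f, head (net_graph N) f}"
      using meet arcs e(2) f(2) unfolding edges_meet_only_at_endpoints_def Let_def by blast
    moreover have "{tail (net_graph N) e, head (net_graph N) e} \<subseteq> set (awalk_verts u p)"
      "{tail (net_graph N) f, head (net_graph N) f} \<subseteq> set (awalk_verts u' q)"
      using awalk_verts_arc1[OF e(1)] awalk_verts_arc1[OF f(1)]
        awalk_verts_arc2[OF p e(1)] awalk_verts_arc2[OF q f(1)] by blast+
    ultimately show thesis using that by blast
  qed
qed

lemma walk_weight_le_entry:
  assumes fin: "fin_digraph (net_graph N)" and drawn: "drawn_left_to_right N" and "i < n" "j < n"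
    and p: "pre_digraph.awalk (net_graph N) (source N i) p (target N j)"
  shows "path_weight N p \<le> tropical_weight_matrix n N $$ (i, j)"
proof -
  interpret fin_digraph "net_graph N" by (rule fin)
  have "p \<in> paths_between N (source N i) (target N j)"
    using awalk_imp_apath[OF wf_digraph_axioms drawn p] by (simp add: paths_between_def)
  moreover have "finite (paths_between N (source N i) (target N j))"
    unfolding paths_between_def by (rule apaths_finite)
  ultimately show ?thesis using assms(3,4) by (auto simp: tropical_weight_matrix_def)
qed

lemma entry_attained_by_walk:
  assumes fin: "fin_digraph (net_graph N)" and "i < n" "j < n"
    and "tropical_weight_matrix n N $$ (i, j) \<noteq> -\<infinity>"
  obtains p where "pre_digraph.awalk (net_graph N) (source N i) p (target N j)"
    "path_weight N p = tropical_weight_matrix n N $$ (i, j)"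
proof -
  interpret fin_digraph "net_graph N" by (rule fin)
  let ?P = "paths_between N (source N i) (target N j)"
  have "finite (path_weight N ` ?P)" unfolding paths_between_def by (intro finite_imageI apaths_finite)
  moreover have "?P \<noteq> {}" and W: "tropical_weight_matrix n N $$ (i, j) = Max (path_weight N ` ?P)"
    using assms by (auto simp: tropical_weight_matrix_def split: if_splits)
  ultimately have "tropical_weight_matrix n N $$ (i, j) \<in> path_weight N ` ?P"
    by (metis Max_in image_is_empty)
  then obtain p where "apath (source N i) p (target N j)"
      "tropical_weight_matrix n N $$ (i, j) = path_weight N p"
    by (auto simp: paths_between_def)
  then show thesis using that[of p] awalkI_apath by simp
qed

lemma path_weight_append: "path_weight N (p @ q) = path_weight N p + path_weight N q"
  by (simp add: path_weight_def)

lemma path_weight_in_Rmax: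
  assumes "\<And>e. e \<in> set p \<Longrightarrow> weight N e \<in> Rmax"
  shows "path_weight N p \<noteq> \<infinity>"
  using assms by (induction p) (auto simp: path_weight_def Rmax_def)

lemma tropical_weight_matrix_in_Rmax:
  assumes "planar_network n N"
  shows "elements_mat (tropical_weight_matrix n N) \<subseteq> Rmax"
proof
  fix x assume "x \<in> elements_mat (tropical_weight_matrix n N)"
  then obtain i j where ij: "i < n" "j < n" "x = tropical_weight_matrix n N $$ (i, j)"
    by (auto simp: tropical_weight_matrix_def dest!: elements_matD)
  have fin: "fin_digraph (net_graph N)" using assms by (simp add: planar_network_def)
  interpret fin_digraph "net_graph N" by (rule fin)
  show "x \<in> Rmax"
  proof (cases "x = -\<infinity>")
    case False
    then obtain p where p: "awalk (source N i) p (target N j)" and w: "path_weight N p = x"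
      using entry_attained_by_walk[OF fin ij(1,2)] ij(3) by metis
    have "\<And>e. e \<in> set p \<Longrightarrow> weight N e \<in> Rmax"
      using assms p unfolding planar_network_def by blast
    then show ?thesis using path_weight_in_Rmax[of p N] w by (simp add: Rmax_def)
  qed (simp add: Rmax_def)
qed

lemma tropical_weight_matrix_monge:
  assumes N: "planar_network n N"
  shows "tropical_monge (tropical_weight_matrix n N)"
  unfolding tropical_monge_def
proof (intro allI impI)
  fix i k j l
  define W where "W = (\<lambda>i j. tropical_weight_matrix n N $$ (i, j))"
  assume "i < k \<and> k < dim_row (tropical_weight_matrix n N) \<and>
    j < l \<and> l < dim_col (tropical_weight_matrix n N)"
  then have *: "i < k" "k < n" "j < l" "l < n" "i < n" "j < n"
    by (auto simp: tropical_weight_matrix_def)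
  have fin: "fin_digraph (net_graph N)" and drawn: "drawn_left_to_right N"
    and meet: "edges_meet_only_at_endpoints N" and bdry: "boundary_vertices n N"
    using N by (auto simp: planar_network_def)
  interpret fin_digraph "net_graph N" by (rule fin)
  have "W a b \<noteq> \<infinity>" if "a < n" "b < n" for a b
    using tropical_weight_matrix_in_Rmax[OF N] that
    by (force simp: W_def Rmax_def tropical_weight_matrix_def)
  then have not_top: "W i l \<noteq> \<infinity>" "W k j \<noteq> \<infinity>" using * by auto
  have "W i l + W k j \<le> W i j + W k l"
  proof (cases "W i l = -\<infinity> \<or> W k j = -\<infinity>")
    case True
    then have "W i l + W k j = -\<infinity>" using not_top by (cases "W i l"; cases "W k j") auto
    show ?thesis unfolding \<open>W i l + W k j = -\<infinity>\<close> by simp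
  next
    case False
    then obtain p q where p: "awalk (source N i) p (target N l)" "path_weight N p = W i l"
      and q: "awalk (source N k) q (target N j)" "path_weight N q = W k j"
      unfolding W_def using entry_attained_by_walk[OF fin] * by metis
    obtain w where w: "w \<in> set (awalk_verts (source N i) p)" "w \<in> set (awalk_verts (source N k) q)"
    proof (rule walks_cross_in_vertex[OF wf_digraph_axioms drawn meet p(1) q(1)])
      show "fst (source N k) = fst (source N i)" "fst (target N j) = fst (target N l)"
        "fst (source N i) < fst (target N l)"
        using bdry * unfolding boundary_vertices_def by metis+
      show "snd (source N i) < snd (source N k)" "snd (target N j) < snd (target N l)"
        using bdry * unfolding boundary_vertices_def by auto
    qed
    obtain p1 p2 where p12: "p = p1 @ p2" "awalk (source N i) p1 w" "awalk w p2 (target N l)"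
      using awalk_decomp[OF p(1) w(1)] by blast
    obtain q1 q2 where q12: "q = q1 @ q2" "awalk (source N k) q1 w" "awalk w q2 (target N j)"
      using awalk_decomp[OF q(1) w(2)] by blast
    have "W i l + W k j = path_weight N (p1 @ q2) + path_weight N (q1 @ p2)"
      unfolding p(2)[symmetric] q(2)[symmetric] p12(1) q12(1) path_weight_append by (simp add: ac_simps)
    also have "\<dots> \<le> W i j + W k l"
      unfolding W_def using * p12 q12
      by (intro add_mono walk_weight_le_entry[OF fin drawn] awalk_appendI) auto
    finally show ?thesis .
  qed
  then show "tropical_weight_matrix n N $$ (i, l) + tropical_weight_matrix n N $$ (k, j)
      \<le> tropical_weight_matrix n N $$ (i, j) + tropical_weight_matrix n N $$ (k, l)"
    by (simp add: W_def)
qed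

section \<open>Finite entries of Monge arrays\<close>

text \<open>
  The array is indexed by all natural numbers, so that no index bounds accompany the
  inequalities; a finite matrix is continued by \<open>-\<infinity>\<close>.
\<close>

locale monge_array =
  fixes m :: "nat \<Rightarrow> nat \<Rightarrow> ereal"
  assumes not_top: "m i j \<noteq> \<infinity>"
    and monge: "\<lbrakk>i < k; j < l\<rbrakk> \<Longrightarrow> m i l + m k j \<le> m i j + m k l"
begin

definition live_column :: "nat \<Rightarrow> bool" where
  "live_column q \<longleftrightarrow> (\<exists>i. m i q \<noteq> -\<infinity>)"

text \<open>
  The value \<open>q\<close> for the case that there is no live column up to \<open>q\<close> makes \<open>filled\<close> equal to \<open>-\<infinity>\<close>
  there, because then column \<open>q\<close> itself is empty.
\<close>

definition last_live :: "nat \<Rightarrow> nat" where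
  "last_live q = (if \<exists>k\<le>q. live_column k then GREATEST k. k \<le> q \<and> live_column k else q)"

text \<open>
  Each empty column is overwritten by the last live column before it. This removes the gaps that
  empty columns leave in the rows, and it preserves the Monge inequalities, as the columns keep
  their order. Paths that end in an empty column are blocked separately.
\<close>

definition filled :: "nat \<Rightarrow> nat \<Rightarrow> ereal" where
  "filled i q = m i (last_live q)"

definition live_row :: "nat \<Rightarrow> bool" where
  "live_row i \<longleftrightarrow> (\<exists>q. filled i q \<noteq> -\<infinity>)"

definition row_start :: "nat \<Rightarrow> nat" where
  "row_start i = (LEAST q. filled i q \<noteq> -\<infinity>)"

lemma last_live_of_live: "live_column q \<Longrightarrow> last_live q = q"
  by (auto simp: last_live_def intro!: Greatest_equality)

lemma filled_live: "live_column q \<Longrightarrow> filled i q = m i q"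
  by (simp add: filled_def last_live_of_live)

lemma last_live_props:
  assumes "\<exists>k\<le>q. live_column k"
  shows "last_live q \<le> q" "live_column (last_live q)" "\<And>k. \<lbrakk>k \<le> q; live_column k\<rbrakk> \<Longrightarrow> k \<le> last_live q"
proof -
  have "last_live q \<le> q \<and> live_column (last_live q)"
    unfolding last_live_def using assms
    by (auto intro: GreatestI_ex_nat[where P = "\<lambda>k. k \<le> q \<and> live_column k" and b = q, THEN conjunct1]
      GreatestI_ex_nat[where P = "\<lambda>k. k \<le> q \<and> live_column k" and b = q, THEN conjunct2])
  then show "last_live q \<le> q" "live_column (last_live q)" by auto
  show "k \<le> last_live q" if "k \<le> q" "live_column k" for k
    unfolding last_live_def using assms that
    by (auto intro!: Greatest_le_nat[where P = "\<lambda>k. k \<le> q \<and> live_column k" and b = q])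
qed

lemma filled_finite_imp_live:
  assumes "filled i q \<noteq> -\<infinity>"
  shows "\<exists>k\<le>q. live_column k"
proof (rule ccontr)
  assume "\<not> ?thesis"
  then have "last_live q = q" "\<not> live_column q" by (auto simp: last_live_def)
  then show False using assms by (simp add: filled_def live_column_def)
qed

lemma last_live_mono:
  assumes "\<exists>k\<le>q. live_column k" "q \<le> q'"
  shows "last_live q \<le> last_live q'"
proof (rule last_live_props(3))
  show "\<exists>k\<le>q'. live_column k" 
  proof -
    obtain k where "k \<le> q" "live_column k" using assms(1) by blast
    then show ?thesis using assms(2) by (intro exI[of _ k]) simp
  qed
  show "last_live q \<le> q'" "live_column (last_live q)"
    using last_live_props(1,2)[OF assms(1)] assms(2) by auto
qed

lemma filled_not_top: "filled i q \<noteq> \<infinity>"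
  by (simp add: filled_def not_top)

lemma filled_monge:
  assumes "i \<le> k" "q \<le> q'"
  shows "filled i q' + filled k q \<le> filled i q + filled k q'"
proof (cases "filled k q = -\<infinity>")
  case True
  then show ?thesis using filled_not_top[of i q'] by (cases "filled i q'") auto
next
  case False
  have "last_live q \<le> last_live q'"
    using last_live_mono[OF filled_finite_imp_live[OF False] assms(2)] .
  then consider "i = k" | "last_live q = last_live q'" | "i < k" "last_live q < last_live q'"
    using assms(1) by linarith
  then show ?thesis
  proof cases
    case 3
    then show ?thesis unfolding filled_def by (rule monge)
  qed (simp_all add: filled_def add.commute)
qed

lemma row_start_finite: "live_row i \<Longrightarrow> filled i (row_start i) \<noteq> -\<infinity>"
  unfolding row_start_def live_row_def by (rule LeastI_ex)

lemma row_start_le: "filled i q \<noteq> -\<infinity> \<Longrightarrow> row_start i \<le> q"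
  unfolding row_start_def by (rule Least_le)

text \<open>
  Otherwise the entries in which the rows start form an antidiagonal of finite weight, so by
  the Monge inequality row \<open>i\<close> would already be finite in column \<open>row_start k\<close>.
\<close>

lemma row_start_mono:
  assumes "i \<le> k" "live_row i" "live_row k"
  shows "row_start i \<le> row_start k"
proof (rule ccontr)
  assume less: "\<not> row_start i \<le> row_start k"
  have "filled i (row_start i) + filled k (row_start k)
      \<le> filled i (row_start k) + filled k (row_start i)"
    using less by (intro filled_monge assms(1)) simp
  moreover have "filled i (row_start i) + filled k (row_start k) \<noteq> -\<infinity>"
    using row_start_finite assms by simp
  ultimately have "filled i (row_start k) \<noteq> -\<infinity>"
    using filled_not_top[of k "row_start i"] by (cases "filled k (row_start i)") auto
  then show False using row_start_le less by blast
qed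

text \<open>
  A gap at \<open>q'\<close> in row \<open>i\<close> cannot be explained by an empty column, since the columns of
  \<open>filled\<close> from the first live one on are all live: some row \<open>k\<close> is finite at \<open>q'\<close>. Then the Monge
  inequality for the rows \<open>i\<close>, \<open>k\<close> and the columns \<open>q, q'\<close> or \<open>q', q''\<close>, according to the order of
  \<open>i\<close> and \<open>k\<close>, bounds a finite sum by \<open>-\<infinity>\<close>.
\<close>

lemma filled_finite_interval:
  assumes "filled i q \<noteq> -\<infinity>" "filled i q'' \<noteq> -\<infinity>" "q \<le> q'" "q' \<le> q''"
  shows "filled i q' \<noteq> -\<infinity>"
proof
  assume zero: "filled i q' = -\<infinity>"
  have "\<exists>k\<le>q'. live_column k"
    using filled_finite_imp_live[OF assms(1)] order_trans[OF _ assms(3)] by blast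
  then have "live_column (last_live q')" by (rule last_live_props(2))
  then obtain k where k: "filled k q' \<noteq> -\<infinity>"
    unfolding filled_def live_column_def by blast
  show False
  proof (cases "k \<le> i")
    case True
    have "filled k q' + filled i q \<le> filled k q + filled i q'"
      using True assms(3) by (rule filled_monge)
    also have "\<dots> = -\<infinity>" using zero filled_not_top[of k q] by (cases "filled k q") auto
    finally show False using k assms(1) by simp
  next
    case False
    then have "filled i q'' + filled k q' \<le> filled i q' + filled k q''"
      using assms(4) by (intro filled_monge) auto
    also have "\<dots> = -\<infinity>" using zero filled_not_top[of k q''] by (cases "filled k q''") auto
    finally show False using k assms(2) by simp
  qed
qed

end

section \<open>Lattice networks\<close>

text \<open>
  The lattice is turned by 45 degrees, so that steps that increase \<open>c\<close> and steps that decrease \<open>r\<close>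
  both run from left to right.
\<close>

definition lattice_point :: "nat \<times> nat \<Rightarrow> point" where
  "lattice_point = (\<lambda>(c, r). (real c - real r, real c + real r))"

text \<open>
  The last two conditions cut out the strip of abscissae between \<open>-n\<close> and \<open>n\<close>.
\<close>

definition lattice_verts :: "nat \<Rightarrow> (nat \<times> nat) set" where
  "lattice_verts n = {(c, r). c < 2 * n \<and> r < 2 * n \<and> c \<le> r + n \<and> r \<le> c + n}"

text \<open>
  An arc is named by a lattice point and a flag. With flag \<open>True\<close> it runs along a row, from column
  \<open>c\<close> to \<open>c + 1\<close>; with flag \<open>False\<close> it runs down a column, from row \<open>r + 1\<close> to \<open>r\<close>.
\<close>

fun arc_start :: "nat \<times> nat \<times> bool \<Rightarrow> nat \<times> nat" where
  "arc_start (c, r, True) = (c, r)"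
| "arc_start (c, r, False) = (c, Suc r)"

fun arc_end :: "nat \<times> nat \<times> bool \<Rightarrow> nat \<times> nat" where
  "arc_end (c, r, True) = (Suc c, r)"
| "arc_end (c, r, False) = (c, r)"

definition lattice_arcs :: "nat \<Rightarrow> (nat \<times> nat \<times> bool) set" where
  "lattice_arcs n = {a. arc_start a \<in> lattice_verts n \<and> arc_end a \<in> lattice_verts n}"

definition lattice_graph :: "nat \<Rightarrow> (point, nat) pre_digraph" where
  "lattice_graph n = \<lparr>verts = lattice_point ` lattice_verts n, arcs = to_nat ` lattice_arcs n,
     tail = (\<lambda>e. lattice_point (arc_start (from_nat e))),
     head = (\<lambda>e. lattice_point (arc_end (from_nat e)))\<rparr>"

text \<open>
  Source \<open>i\<close> lies in lattice row \<open>i + n\<close>, target \<open>j\<close> in lattice column \<open>n + j\<close>. The matrix thus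
  occupies the quadrant \<open>n \<le> c\<close>, \<open>n \<le> r\<close>, with row and column numbers shifted by \<open>n\<close>; to the left of
  it the sources enter their rows, and below it the columns lead to their targets.
\<close>

definition lattice_network :: "nat \<Rightarrow> (nat \<times> nat \<times> bool \<Rightarrow> ereal) \<Rightarrow> nat network" where
  "lattice_network n w = \<lparr>net_graph = lattice_graph n, weight = (\<lambda>e. w (from_nat e)),
     curve = (\<lambda>e. linepath (tail (lattice_graph n) e) (head (lattice_graph n) e)),
     source = (\<lambda>i. lattice_point (i, i + n)), target = (\<lambda>j. lattice_point (n + j, j))\<rparr>"

lemma lattice_graph_simps [simp]:
  "verts (lattice_graph n) = lattice_point ` lattice_verts n"
  "arcs (lattice_graph n) = to_nat ` lattice_arcs n"
  "tail (lattice_graph n) (to_nat a) = lattice_point (arc_start a)"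
  "head (lattice_graph n) (to_nat a) = lattice_point (arc_end a)"
  by (simp_all add: lattice_graph_def)

lemma lattice_network_simps [simp]:
  "net_graph (lattice_network n w) = lattice_graph n"
  "weight (lattice_network n w) (to_nat a) = w a"
  "curve (lattice_network n w) (to_nat a) =
     linepath (lattice_point (arc_start a)) (lattice_point (arc_end a))"
  "source (lattice_network n w) i = lattice_point (i, i + n)"
  "target (lattice_network n w) j = lattice_point (n + j, j)"
  by (simp_all add: lattice_network_def)

lemma inj_lattice_point: "inj lattice_point"
  by (auto simp: inj_on_def lattice_point_def)

lemma finite_lattice_verts: "finite (lattice_verts n)"
  by (rule finite_subset[of _ "{..<2 * n} \<times> {..<2 * n}"]) (auto simp: lattice_verts_def)

lemma finite_lattice_arcs: "finite (lattice_arcs n)"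
proof (rule finite_subset)
  show "lattice_arcs n \<subseteq> {..<2 * n} \<times> {..<2 * n} \<times> UNIV"
  proof
    fix a assume "a \<in> lattice_arcs n"
    then show "a \<in> {..<2 * n} \<times> {..<2 * n} \<times> UNIV"
      by (cases a rule: arc_start.cases) (auto simp: lattice_arcs_def lattice_verts_def)
  qed
qed auto

lemma point_on_lattice_arc:
  assumes "z \<in> path_image (linepath (lattice_point (arc_start (c, r, b))) (lattice_point (arc_end (c, r, b))))"
  obtains x y where "z = (x - y, x + y)"
    "if b then y = real r \<and> real c \<le> x \<and> x \<le> real c + 1
     else x = real c \<and> real r \<le> y \<and> y \<le> real r + 1"
proof -
  obtain t where t: "0 \<le> t" "t \<le> 1"
    "z = (1 - t) *\<^sub>R lattice_point (arc_start (c, r, b)) + t *\<^sub>R lattice_point (arc_end (c, r, b))"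
    using assms by (auto simp: path_image_linepath closed_segment_def)
  show thesis
  proof (cases b)
    case True
    then have "z = (real c + t - real r, real c + t + real r)"
      using t(3) by (simp add: lattice_point_def algebra_simps)
    then show thesis using True t(1,2) by (intro that[of "real c + t" "real r"]) auto
  next
    case False
    then have "z = (real c - (real r + 1 - t), real c + (real r + 1 - t))"
      using t(3) by (simp add: lattice_point_def algebra_simps)
    then show thesis using False t(1,2) by (intro that[of "real c" "real r + 1 - t"]) auto
  qed
qed

lemma lattice_point_on_arc_is_endpoint:
  assumes "lattice_point (c', r') \<in>
    path_image (linepath (lattice_point (arc_start a)) (lattice_point (arc_end a)))"
  shows "lattice_point (c', r') \<in> {lattice_point (arc_start a), lattice_point (arc_end a)}"
proof -
  obtain c r b where a: "a = (c, r, b)" by (cases a)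
  obtain x y where xy: "lattice_point (c', r') = (x - y, x + y)"
    "if b then y = real r \<and> real c \<le> x \<and> x \<le> real c + 1
     else x = real c \<and> real r \<le> y \<and> y \<le> real r + 1"
    using point_on_lattice_arc assms unfolding a by metis
  have "x = real c'" "y = real r'" using xy(1) by (auto simp: lattice_point_def)
  with xy(2) have "if b then r' = r \<and> (c' = c \<or> c' = Suc c) else c' = c \<and> (r' = r \<or> r' = Suc r)"
    by (auto split: if_splits)
  then show ?thesis by (cases b) (auto simp: a)
qed

text \<open>
  In lattice coordinates an arc is a unit segment with one integral coordinate and the other one
  between two consecutive integers. Perpendicular arcs therefore meet in a point with two integral
  coordinates, and different parallel arcs meet at most where one ends and the other starts.
\<close>

lemma lattice_arcs_cross_at_lattice_point:
  assumes "a \<noteq> a'"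
    and "z \<in> path_image (linepath (lattice_point (arc_start a)) (lattice_point (arc_end a)))"
    and "z \<in> path_image (linepath (lattice_point (arc_start a')) (lattice_point (arc_end a')))"
  obtains v where "z = lattice_point v"
proof -
  obtain c r b where a: "a = (c, r, b)" by (cases a)
  obtain c' r' b' where a': "a' = (c', r', b')" by (cases a')
  obtain x y where xy: "z = (x - y, x + y)"
    "if b then y = real r \<and> real c \<le> x \<and> x \<le> real c + 1
     else x = real c \<and> real r \<le> y \<and> y \<le> real r + 1"
    using point_on_lattice_arc assms(2) unfolding a by metis
  obtain x' y' where xy': "z = (x' - y', x' + y')"
    "if b' then y' = real r' \<and> real c' \<le> x' \<and> x' \<le> real c' + 1
     else x' = real c' \<and> real r' \<le> y' \<and> y' \<le> real r' + 1"
    using point_on_lattice_arc assms(3) unfolding a' by metis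
  have [simp]: "x' = x" "y' = y" using xy(1) xy'(1) by auto
  \<comment> \<open>Two different unit intervals with integral ends share at most an end.\<close>
  have gap: "t = real (max k k')"
    if "real k \<le> t" "t \<le> real k + 1" "real k' \<le> t" "t \<le> real k' + 1" "k \<noteq> k'" for k k' t
    using that by (cases "k < k'") (auto simp: max_def)
  have "\<exists>c r. x = real c \<and> y = real r"
    using xy(2) xy'(2) assms(1) gap[of c x c'] gap[of r y r'] unfolding a a'
    by (cases b; cases b') auto
  then obtain c r where "x = real c" "y = real r" by blast
  then show thesis using xy(1) that[of "(c, r)"] by (simp add: lattice_point_def)
qed

lemma planar_lattice_network:
  assumes "\<And>a. w a \<noteq> \<infinity>"
  shows "planar_network n (lattice_network n w)"
proof -
  have fin: "fin_digraph (lattice_graph n)"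
    by unfold_locales
      (use finite_lattice_verts finite_lattice_arcs in \<open>auto simp: lattice_arcs_def\<close>)
  then have wf: "wf_digraph (net_graph (lattice_network n w))" by (simp add: fin_digraph_def)
  have right: "fst (lattice_point (arc_end a)) = fst (lattice_point (arc_start a)) + 1" for a
    by (cases a rule: arc_start.cases) (auto simp: lattice_point_def)
  have "fst (linepath (lattice_point (arc_start a)) (lattice_point (arc_end a)) t) =
      fst (lattice_point (arc_start a)) + t" for a t
    by (simp add: linepath_def right algebra_simps)
  then have drawn: "drawn_left_to_right (lattice_network n w)"
    unfolding drawn_left_to_right_def by (auto simp: strict_mono_on_def)
  have meet: "edges_meet_only_at_endpoints (lattice_network n w)"
    unfolding edges_meet_only_at_endpoints_def Let_def
  proof (intro conjI ballI impI subsetI)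
    fix e f z
    assume arcs: "e \<in> arcs (net_graph (lattice_network n w))"
        "f \<in> arcs (net_graph (lattice_network n w))" and "e \<noteq> f"
    obtain a a' :: "nat \<times> nat \<times> bool" where "e = to_nat a" "f = to_nat a'"
      using arcs unfolding lattice_network_simps lattice_graph_simps by blast
    then have a: "e = to_nat a" "f = to_nat a'" "a \<noteq> a'" using \<open>e \<noteq> f\<close> by auto
    assume "z \<in> path_image (curve (lattice_network n w) e) \<inter> path_image (curve (lattice_network n w) f)"
    then have z: "z \<in> path_image (linepath (lattice_point (arc_start a)) (lattice_point (arc_end a)))"
        "z \<in> path_image (linepath (lattice_point (arc_start a')) (lattice_point (arc_end a')))"
      by (simp_all add: a)
    obtain v where "z = lattice_point v" using lattice_arcs_cross_at_lattice_point[OF a(3) z] .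
    with z show "z \<in> {tail (net_graph (lattice_network n w)) e, head (net_graph (lattice_network n w)) e} \<inter>
        {tail (net_graph (lattice_network n w)) f, head (net_graph (lattice_network n w)) f}"
      using lattice_point_on_arc_is_endpoint[of "fst v" "snd v"] by (simp add: a)
  next
    fix e z
    assume "e \<in> arcs (net_graph (lattice_network n w))"
    then obtain a :: "nat \<times> nat \<times> bool" where a: "e = to_nat a" by auto
    assume z: "z \<in> path_image (curve (lattice_network n w) e) \<inter> verts (net_graph (lattice_network n w))"
    then obtain c r where "z = lattice_point (c, r)" by auto
    with z show "z \<in> {tail (net_graph (lattice_network n w)) e, head (net_graph (lattice_network n w)) e}"
      using lattice_point_on_arc_is_endpoint[of c r a] by (simp add: a)
  qed
  have bdry: "boundary_vertices n (lattice_network n w)"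
    unfolding boundary_vertices_def
  proof (intro conjI)
    show "\<forall>i<n. source (lattice_network n w) i \<in> verts (net_graph (lattice_network n w)) \<and>
        target (lattice_network n w) i \<in> verts (net_graph (lattice_network n w))"
      by (auto simp: lattice_verts_def intro!: imageI)
    show "\<exists>a b. a < b \<and>
        (\<forall>v\<in>verts (net_graph (lattice_network n w)). a \<le> fst v \<and> fst v \<le> b) \<and>
        (\<forall>i<n. fst (source (lattice_network n w) i) = a \<and> fst (target (lattice_network n w) i) = b)"
    proof (cases "n = 0")
      case True
      \<comment> \<open>The lattice is empty, but the strip must still have positive width.\<close>
      then show ?thesis by (auto simp: lattice_verts_def intro: exI[of _ 0] exI[of _ 1])
    next
      case False
      then show ?thesis
        by (intro exI[of _ "- real n"] exI[of _ "real n"]) (auto simp: lattice_verts_def lattice_point_def)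
    qed
  qed (auto simp: lattice_point_def)
  show ?thesis
    using fin no_cycle[OF wf drawn] drawn meet bdry assms
    by (auto simp: planar_network_def Rmax_def)
qed

text \<open>
  The dual certificate for longest paths: a potential that grows along each edge by at least
  its weight grows along each walk by at least the weight of the walk.
\<close>

lemma path_weight_le_potential:
  fixes \<phi> :: "point \<Rightarrow> ereal"
  assumes wf: "wf_digraph (net_graph N)"
    and step: "\<And>e. e \<in> arcs (net_graph N) \<Longrightarrow>
      \<phi> (tail (net_graph N) e) + weight N e \<le> \<phi> (head (net_graph N) e)"
    and "pre_digraph.awalk (net_graph N) u p v"
  shows "\<phi> u + path_weight N p \<le> \<phi> v"
  using assms(3)
proof (induction p arbitrary: u)
  case Nil
  then show ?case by (auto simp: path_weight_def wf_digraph.awalk_Nil_iff[OF wf])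
next
  case (Cons e p)
  then have e: "e \<in> arcs (net_graph N)" "u = tail (net_graph N) e"
    and p: "pre_digraph.awalk (net_graph N) (head (net_graph N) e) p v"
    by (auto simp: wf_digraph.awalk_Cons_iff[OF wf])
  have "\<phi> u + path_weight N (e # p) = (\<phi> u + weight N e) + path_weight N p"
    by (simp add: path_weight_def add.assoc)
  also have "\<dots> \<le> \<phi> (head (net_graph N) e) + path_weight N p"
    using step e by (intro add_mono) auto
  also have "\<dots> \<le> \<phi> v" using Cons.IH p by blast
  finally show ?case .
qed

definition lattice_walk ::
  "nat \<Rightarrow> (nat \<times> nat \<times> bool \<Rightarrow> ereal) \<Rightarrow> nat \<times> nat \<Rightarrow> nat \<times> nat \<Rightarrow> ereal \<Rightarrow> bool" where
  "lattice_walk n w x y s \<longleftrightarrow>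
     (\<exists>p. pre_digraph.awalk (lattice_graph n) (lattice_point x) p (lattice_point y) \<and>
        path_weight (lattice_network n w) p = s)"

lemma lattice_walk_refl: "x \<in> lattice_verts n \<Longrightarrow> lattice_walk n w x x 0"
  unfolding lattice_walk_def
  by (intro exI[of _ "[]"]) (auto simp: path_weight_def pre_digraph.awalk_def pre_digraph.cas.simps)

lemma lattice_walk_extend:
  assumes "lattice_walk n w x (arc_start a) s" "a \<in> lattice_arcs n" "s' = s + w a"
  shows "lattice_walk n w x (arc_end a) s'"
proof -
  interpret wf_digraph "lattice_graph n"
    by unfold_locales (auto simp: lattice_arcs_def)
  obtain p where p: "awalk (lattice_point x) p (lattice_point (arc_start a))"
    "path_weight (lattice_network n w) p = s"
    using assms(1) by (auto simp: lattice_walk_def)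
  have "awalk (lattice_point x) (p @ [to_nat a]) (lattice_point (arc_end a))"
    using arc_implies_awalk[of "to_nat a"] assms(2) by (intro awalk_appendI[OF p(1)]) simp
  moreover have "path_weight (lattice_network n w) (p @ [to_nat a]) = s'"
    using p(2) assms(3) by (simp add: path_weight_def)
  ultimately show ?thesis unfolding lattice_walk_def by blast
qed

text \<open>
  To find the weight matrix of a lattice network it suffices to give, for each source, a potential
  that bounds the weights of all paths from it, and a walk for each finite entry.
\<close>

lemma tropical_weight_matrix_lattice_network:
  assumes M: "M \<in> carrier_mat n n" and w: "\<And>a. w a \<noteq> \<infinity>"
    and start: "\<And>i. i < n \<Longrightarrow> \<psi> i (i, i + n) = 0"
    and step: "\<And>i a. i < n \<Longrightarrow> \<psi> i (arc_start a) + w a \<le> \<psi> i (arc_end a)"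
    and stop: "\<And>i j. \<lbrakk>i < n; j < n\<rbrakk> \<Longrightarrow> \<psi> i (n + j, j) \<le> M $$ (i, j)"
    and reach: "\<And>i j. \<lbrakk>i < n; j < n; M $$ (i, j) \<noteq> -\<infinity>\<rbrakk> \<Longrightarrow>
      lattice_walk n w (i, i + n) (n + j, j) (M $$ (i, j))"
  shows "tropical_weight_matrix n (lattice_network n w) = M"
proof (rule eq_matI)
  define N where "N = lattice_network n w"
  have "planar_network n N" unfolding N_def by (rule planar_lattice_network[OF w])
  then have fin: "fin_digraph (net_graph N)" and drawn: "drawn_left_to_right N"
    by (auto simp: planar_network_def)
  then have wf: "wf_digraph (net_graph N)" by (simp add: fin_digraph_def)
  fix i j
  assume "i < dim_row M" "j < dim_col M"
  then have ij: "i < n" "j < n" using M by auto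
  define \<phi> where "\<phi> = (\<lambda>z. \<psi> i (the_inv lattice_point z))"
  have \<phi>: "\<phi> (lattice_point x) = \<psi> i x" for x
    by (simp add: \<phi>_def the_inv_f_f inj_lattice_point)
  have "tropical_weight_matrix n N $$ (i, j) \<le> M $$ (i, j)"
  proof (cases "tropical_weight_matrix n N $$ (i, j) = -\<infinity>")
    case False
    then obtain p where p: "pre_digraph.awalk (net_graph N) (source N i) p (target N j)"
      "path_weight N p = tropical_weight_matrix n N $$ (i, j)"
      using entry_attained_by_walk[OF fin ij] by blast
    have "\<phi> (source N i) + path_weight N p \<le> \<phi> (target N j)"
      by (rule path_weight_le_potential[OF wf _ p(1)]) (auto simp: N_def \<phi> step ij)
    then show ?thesis using start[OF ij(1)] stop[OF ij] p(2) by (auto simp: N_def \<phi>)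
  qed simp
  moreover have "M $$ (i, j) \<le> tropical_weight_matrix n N $$ (i, j)"
  proof (cases "M $$ (i, j) = -\<infinity>")
    case False
    then obtain p where "pre_digraph.awalk (net_graph N) (source N i) p (target N j)"
      "path_weight N p = M $$ (i, j)"
      using reach[OF ij] by (auto simp: lattice_walk_def N_def)
    then show ?thesis using walk_weight_le_entry[OF fin drawn ij] by metis
  qed simp
  ultimately show "tropical_weight_matrix n (lattice_network n w) $$ (i, j) = M $$ (i, j)"
    by (simp add: N_def)
qed (use M in \<open>simp_all add: tropical_weight_matrix_def\<close>)

section \<open>Realization of Monge matrices\<close>

context monge_array
begin

text \<open>
  A path collects the entry \<open>filled p (row_start p)\<close> when it arrives in the first finite column of
  its row and the increments of the row afterwards. A row that is \<open>-\<infinity>\<close> throughout cannot be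
  followed, but it can be crossed downwards. Descents are blocked before the row has started, and
  when they leave the quadrant of the matrix (\<open>Suc r = n\<close>) through an empty column.
\<close>

fun lattice_weight :: "nat \<Rightarrow> nat \<times> nat \<times> bool \<Rightarrow> ereal" where
  "lattice_weight n (c, r, True) =
     (if r < n \<or> \<not> live_row (r - n) then -\<infinity>
      else if Suc c < n + row_start (r - n) then 0
      else if Suc c = n + row_start (r - n) then filled (r - n) (row_start (r - n))
      else if filled (r - n) (c - n) = -\<infinity> \<or> filled (r - n) (Suc c - n) = -\<infinity> then -\<infinity>
      else filled (r - n) (Suc c - n) - filled (r - n) (c - n))"
| "lattice_weight n (c, r, False) =
     (if n \<le> c \<and> (n \<le> Suc r \<and> live_row (Suc r - n) \<longrightarrow> n + row_start (Suc r - n) \<le> c) \<and>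
         (Suc r = n \<longrightarrow> live_column (c - n))
      then 0 else -\<infinity>)"

text \<open>
  An upper bound for the weight that a path from source \<open>i\<close> has collected at \<open>(c, r)\<close>, with
  \<open>-\<infinity>\<close> where such a path cannot arrive at finite weight. From column \<open>row_start i\<close> of the matrix
  on, the row matters only in so far as the empty columns are closed below the quadrant.
\<close>

definition potential :: "nat \<Rightarrow> nat \<Rightarrow> nat \<times> nat \<Rightarrow> ereal" where
  "potential n i = (\<lambda>(c, r).
     if \<not> live_row i then (if (c, r) = (i, i + n) then 0 else -\<infinity>)
     else if i + n < r then -\<infinity>
     else if c < n + row_start i then (if r = i + n then 0 else -\<infinity>)
     else if n \<le> r then filled i (c - n) else m i (c - n))"

lemma lattice_weight_not_top: "lattice_weight n a \<noteq> \<infinity>"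
proof (cases "(n, a)" rule: lattice_weight.cases)
  case (1 n' c r)
  have "x - y \<noteq> \<infinity>" if "x \<noteq> \<infinity>" "y \<noteq> -\<infinity>" for x y :: ereal
    using that by (cases x; cases y) auto
  then show ?thesis using 1 filled_not_top by auto
qed auto

lemma potential_not_top: "potential n i x \<noteq> \<infinity>"
  by (auto simp: potential_def filled_not_top not_top split: prod.splits)

text \<open>
  The only case with content is a row step in a row \<open>p\<close> below row \<open>i\<close>: the increment of row \<open>p\<close>
  is at most that of row \<open>i\<close>, which is the Monge inequality for two consecutive columns. Since
  \<open>row_start p \<le> row_start i\<close>, such a step never runs through the weightless part of row \<open>p\<close>.
\<close>

lemma potential_step:
  assumes "i < n"
  shows "potential n i (arc_start a) + lattice_weight n a \<le> potential n i (arc_end a)"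
proof (cases "potential n i (arc_start a) = -\<infinity> \<or> lattice_weight n a = -\<infinity>")
  case True
  then have bot: "potential n i (arc_start a) + lattice_weight n a = -\<infinity>"
    using potential_not_top[of n i "arc_start a"] lattice_weight_not_top[of n a]
    by (cases "potential n i (arc_start a)"; cases "lattice_weight n a") auto
  show ?thesis unfolding bot by simp
next
  case False
  then have start: "potential n i (arc_start a) \<noteq> -\<infinity>" and weight: "lattice_weight n a \<noteq> -\<infinity>" by auto
  show ?thesis
  proof (cases "(n, a)" rule: lattice_weight.cases)
    case (1 n' c r)
    then have a: "a = (c, r, True)" by simp
    define p where "p = r - n"
    from weight have r: "n \<le> r" "live_row p" by (auto simp: a p_def split: if_splits)
    have live: "live_row i"
      using start r by (auto simp: a p_def potential_def split: if_splits)
    have pi: "p \<le> i" "r = p + n" using start r live by (auto simp: a p_def potential_def split: if_splits)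
    show ?thesis
    proof (cases "n + row_start i \<le> c")
      case False
      then have "p = i" using start live pi by (auto simp: a potential_def split: if_splits)
      moreover have "Suc c < n + row_start i \<or> Suc c - n = row_start i" using False by linarith
      ultimately show ?thesis using False live pi by (auto simp: a potential_def)
    next
      case True
      define q where "q = c - n"
      have c: "c = n + q" "row_start i \<le> q" using True by (auto simp: q_def)
      have "row_start p \<le> q" using row_start_mono[OF pi(1) r(2) live] c by simp
      then have w: "lattice_weight n a = filled p (Suc q) - filled p q"
        and fin: "filled p q \<noteq> -\<infinity>" "filled p (Suc q) \<noteq> -\<infinity>"
        using weight r by (auto simp: a pi(2) c(1) Suc_diff_le split: if_splits)
      have "filled p (Suc q) + filled i q \<le> filled p q + filled i (Suc q)"
        using pi(1) by (intro filled_monge) auto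
      then have "filled i q + (filled p (Suc q) - filled p q) \<le> filled i (Suc q)"
        using fin filled_not_top[of p q] filled_not_top[of p "Suc q"]
          filled_not_top[of i q] filled_not_top[of i "Suc q"]
        by (cases "filled p q"; cases "filled p (Suc q)"; cases "filled i q"; cases "filled i (Suc q)") auto
      moreover have "potential n i (arc_start a) = filled i q" "potential n i (arc_end a) = filled i (Suc q)"
        using live pi c by (auto simp: a potential_def Suc_diff_le)
      ultimately show ?thesis by (simp add: w)
    qed
  next
    case (2 n' c r)
    then have a: "a = (c, r, False)" by simp
    from weight have c: "n \<le> c" "n \<le> Suc r \<Longrightarrow> live_row (Suc r - n) \<Longrightarrow> n + row_start (Suc r - n) \<le> c"
        "Suc r = n \<Longrightarrow> live_column (c - n)" and w: "lattice_weight n a = 0"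
      by (auto simp: a split: if_splits)
    have live: "live_row i"
      using start c(1) assms by (auto simp: a potential_def split: if_splits)
    have r: "Suc r \<le> i + n" using start live by (auto simp: a potential_def split: if_splits)
    have "n + row_start i \<le> c"
      using start live c(2) by (cases "Suc r = i + n") (auto simp: a potential_def split: if_splits)
    then have "potential n i (arc_start a) \<le> potential n i (arc_end a)"
      using live r c(3) filled_live[of "c - n" i] by (auto simp: a potential_def)
    then show ?thesis by (simp add: w)
  qed
qed

lemma potential_source: "i < n \<Longrightarrow> potential n i (i, i + n) = 0"
  by (simp add: potential_def)

lemma potential_target: "\<lbrakk>i < n; j < n\<rbrakk> \<Longrightarrow> potential n i (n + j, j) \<le> m i j"
  by (simp add: potential_def)

text \<open>
  The walk along row \<open>i\<close> up to column \<open>n + j\<close>, then down to the target. On row \<open>i\<close> the potential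
  grows by exactly the weight, because the entries between \<open>row_start i\<close> and \<open>j\<close> are finite; the
  descent is free because \<open>j\<close> is not to the left of the start of any lower row.
\<close>

lemma peak_walk:
  assumes "i < n" "j < n" and fin: "m i j \<noteq> -\<infinity>"
  shows "lattice_walk n (lattice_weight n) (i, i + n) (n + j, j) (m i j)"
proof -
  have col: "live_column j" using fin by (auto simp: live_column_def)
  then have fij: "filled i j = m i j" by (rule filled_live)
  then have live: "live_row i" using fin unfolding live_row_def by metis
  have start: "row_start i \<le> j" using row_start_le fij fin by simp
  have up: "lattice_walk n (lattice_weight n) (i, i + n) (c, i + n) (potential n i (c, i + n))"
    if "i \<le> c" "c \<le> n + j" for c
    using that
  proof (induction c rule: dec_induct)
    case base
    have "potential n i (i, i + n) = 0" using assms(1) by (simp add: potential_def)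
    then show ?case
      using assms(1) lattice_walk_refl[of "(i, i + n)"] by (simp add: lattice_verts_def)
  next
    case (step c)
    have "potential n i (Suc c, i + n) = potential n i (c, i + n) + lattice_weight n (c, i + n, True)"
    proof (cases "n + row_start i \<le> c")
      case False
      then have "Suc c < n + row_start i \<or> Suc c - n = row_start i" by linarith
      then show ?thesis using False live by (auto simp: potential_def)
    next
      case True
      define q where "q = c - n"
      have c: "c = n + q" "row_start i \<le> q" using True by (auto simp: q_def)
      have q: "Suc q \<le> j" using step.prems c by simp
      have "filled i q \<noteq> -\<infinity>" "filled i (Suc q) \<noteq> -\<infinity>"
        using filled_finite_interval[OF row_start_finite[OF live]] fij fin c q by (metis le_Suc_eq Suc_leD)+
      moreover from this have "filled i (Suc q) = filled i q + (filled i (Suc q) - filled i q)"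
        using filled_not_top[of i q] by (cases "filled i q"; cases "filled i (Suc q)") auto
      ultimately show ?thesis using live c by (simp add: potential_def Suc_diff_le)
    qed
    moreover have "(c, i + n, True) \<in> lattice_arcs n"
      using step assms by (auto simp: lattice_arcs_def lattice_verts_def)
    moreover have "lattice_walk n (lattice_weight n) (i, i + n) (arc_start (c, i + n, True))
        (potential n i (c, i + n))"
      using step by simp
    ultimately have "lattice_walk n (lattice_weight n) (i, i + n) (arc_end (c, i + n, True))
        (potential n i (Suc c, i + n))"
      by (intro lattice_walk_extend)
    then show ?case by simp
  qed
  have "potential n i (n + j, i + n) = m i j" using live start fij by (simp add: potential_def)
  then have top: "lattice_walk n (lattice_weight n) (i, i + n) (n + j, i + n) (m i j)"
    using up[of "n + j"] assms by simp
  have "lattice_walk n (lattice_weight n) (i, i + n) (n + j, r) (m i j)"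
    if "j \<le> r" "r \<le> i + n" for r
    using that(2,1)
  proof (induction r rule: inc_induct)
    case base
    show ?case by (rule top)
  next
    case (step r)
    have "row_start (Suc r - n) \<le> j" if "live_row (Suc r - n)"
      using row_start_mono[OF _ that live] step start by fastforce
    then have "lattice_weight n (n + j, r, False) = 0" using col by simp
    moreover have "(n + j, r, False) \<in> lattice_arcs n"
      using step assms by (auto simp: lattice_arcs_def lattice_verts_def)
    moreover have "lattice_walk n (lattice_weight n) (i, i + n) (arc_start (n + j, r, False)) (m i j)"
      using step by simp
    ultimately have "lattice_walk n (lattice_weight n) (i, i + n) (arc_end (n + j, r, False)) (m i j)"
      by (intro lattice_walk_extend) simp_all
    then show ?case by simp
  qed
  from this[of j] show ?thesis using assms by simp
qed

end

text \<open>
  The Monge inequalities survive the continuation by \<open>-\<infinity>\<close>: if \<open>k\<close> or \<open>l\<close> lies outside the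
  matrix, then \<open>M k j\<close> or \<open>M i l\<close> is \<open>-\<infinity>\<close>, and so is the left-hand side.
\<close>

lemma tropical_monge_realizable:
  assumes M: "M \<in> carrier_mat n n" and Rmax: "elements_mat M \<subseteq> Rmax" and "tropical_monge M"
  shows "\<exists>N :: nat network. planar_network n N \<and> tropical_weight_matrix n N = M"
proof -
  define m where "m = (\<lambda>i j. if i < n \<and> j < n then M $$ (i, j) else -\<infinity>)"
  have not_top: "m i j \<noteq> \<infinity>" for i j
    using M Rmax elements_matI[OF M, of i j "M $$ (i, j)"] by (auto simp: m_def Rmax_def)
  interpret monge_array m
  proof
    fix i k j l :: nat
    assume "i < k" "j < l"
    show "m i l + m k j \<le> m i j + m k l"
    proof (cases "k < n \<and> l < n")
      case True
      then show ?thesis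
        using tropical_mongeD[OF assms(3), of i k j l] M \<open>i < k\<close> \<open>j < l\<close> by (simp add: m_def)
    next
      case False
      then have "m i l = -\<infinity> \<or> m k j = -\<infinity>" by (auto simp: m_def)
      then have bot: "m i l + m k j = -\<infinity>"
        using not_top[of i l] not_top[of k j] by (cases "m i l"; cases "m k j") auto
      show ?thesis unfolding bot by simp
    qed
  qed (rule not_top)
  have "tropical_weight_matrix n (lattice_network n (lattice_weight n)) = M"
  proof (rule tropical_weight_matrix_lattice_network[OF M lattice_weight_not_top, where \<psi> = "potential n"])
    show "potential n i (i, i + n) = 0" if "i < n" for i using that by (rule potential_source)
    show "potential n i (arc_start a) + lattice_weight n a \<le> potential n i (arc_end a)" if "i < n" for i a
      using that by (rule potential_step)
    show "potential n i (n + j, j) \<le> M $$ (i, j)" if "i < n" "j < n" for i j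
    proof -
      have "potential n i (n + j, j) \<le> m i j" using that by (intro potential_target)
      also have "m i j = M $$ (i, j)" using that by (simp add: m_def)
      finally show ?thesis .
    qed
    show "lattice_walk n (lattice_weight n) (i, i + n) (n + j, j) (M $$ (i, j))"
      if "i < n" "j < n" "M $$ (i, j) \<noteq> -\<infinity>" for i j
    proof -
      have m: "m i j = M $$ (i, j)" using that by (simp add: m_def)
      show ?thesis using peak_walk[of i n j] that unfolding m by blast
    qed
  qed
  moreover have "planar_network n (lattice_network n (lattice_weight n))"
    by (intro planar_lattice_network lattice_weight_not_top)
  ultimately show ?thesis by blast
qed

theorem corollary7p9:
  fixes n :: nat
  shows "(\<forall>N :: 'e network. planar_network n N \<longrightarrow>
            tropical_totally_nonnegative (tropical_weight_matrix n N)) \<and>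
         (\<forall>M \<in> carrier_mat n n. tropical_totally_nonnegative M \<longrightarrow>
            (\<exists>N :: nat network. planar_network n N \<and> tropical_weight_matrix n N = M))"
proof (intro conjI allI impI ballI)
  fix N :: "'e network" assume "planar_network n N"
  then show "tropical_totally_nonnegative (tropical_weight_matrix n N)"
    unfolding tropical_totally_nonnegative_iff
    using tropical_weight_matrix_in_Rmax tropical_weight_matrix_monge by blast
next
  fix M assume "M \<in> carrier_mat n n" "tropical_totally_nonnegative M"
  then show "\<exists>N :: nat network. planar_network n N \<and> tropical_weight_matrix n N = M"
    unfolding tropical_totally_nonnegative_iff using tropical_monge_realizable by blast
qed

end
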